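(* Let $X$ be a complex Banach space and let $A:X\rightarrow X$ be a bounded linear operator. Let $D_\infty$ denote the unbounded connected component of the resolvent set $\rho(A)$, and assume that $0\in\overline{D}_\infty$. Then $$X=R(A)\oplus N(A)$$ if and only if $R(A)$ is closed and $\phi_C(A)<\pi$ for some unbounded curve $C$ in the complex plane emanating from the origin.
   Context: $R(A)$ and $N(A)$ denote the range and the kernel of $A$. $X=R(A)\oplus N(A)$ means $R(A)+N(A)=X$ and $R(A)\cap N(A)=\{0\}$. An unbounded curve emanating from the origin is the image $C=\gamma([0,\infty))$ of a continuous map $\gamma:[0,\infty)\to\mathbb{C}$ with $\gamma(0)=0$ and $C$ unbounded. For $x,y\in X$ with $x\neq 0$ put $$s_C(x,y)=\inf_{\lambda\in C}\frac{\|x-\lambda y\|}{\|x\|}.$$ The sine of $A$ along $C$ is $\sin_C A=\inf_{x\notin N(A)}s_C(Ax,x)\in[0,1]$ (for $A=0$, where the infimum is over the empty set, set $\sin_C A=1$). The angle $\phi_C(A)$ of $A$ along $C$ is acute (lies in $[0,\pi/2]$) if $\sin_C A=1$, and $\phi_C(A)=\pi-\arcsin(\sin_C A)$ otherwise. Thus $\phi_C(A)<\pi$ if and only if $\sin_C A>0$, i.e. there is $c>0$ with $\|Ax-\lambda x\|\geq c\|Ax\|$ for all $x\in X$ and $\lambda\in C$. *)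

theory Defs
  imports "HOL-Analysis.Analysis"
begin

class complex_normed_vector = real_normed_vector +
  fixes scaleC :: "complex \<Rightarrow> 'a \<Rightarrow> 'a"  (infixr \<open>*\<^sub>C\<close> 75)
  assumes scaleC_add_right: "a *\<^sub>C (x + y) = a *\<^sub>C x + a *\<^sub>C y"
    and scaleC_add_left: "(a + b) *\<^sub>C x = a *\<^sub>C x + b *\<^sub>C x"
    and scaleC_scaleC: "a *\<^sub>C (b *\<^sub>C x) = (a * b) *\<^sub>C x"
    and scaleC_of_real: "complex_of_real r *\<^sub>C x = r *\<^sub>R x"
    and norm_scaleC: "norm (a *\<^sub>C x) = cmod a * norm x"

class complex_banach = complex_normed_vector + banach

instantiation complex :: complex_banach
begin

definition scaleC_complex :: "complex \<Rightarrow> complex \<Rightarrow> complex"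
  where "scaleC_complex a x = a * x"

instance
  by standard (simp_all add: scaleC_complex_def algebra_simps norm_mult scaleR_conv_of_real)

end

definition bounded_clinear ::
    "('a::complex_normed_vector \<Rightarrow> 'b::complex_normed_vector) \<Rightarrow> bool"
  where "bounded_clinear f \<longleftrightarrow>
    bounded_linear f \<and> (\<forall>a x. f (a *\<^sub>C x) = a *\<^sub>C f x)"

definition null_space :: "('a::complex_normed_vector \<Rightarrow> 'b::complex_normed_vector) \<Rightarrow> 'a set"
  where "null_space A = {x. A x = 0}"

definition resolvent_set :: "('a::complex_normed_vector \<Rightarrow> 'a) \<Rightarrow> complex set"
  where "resolvent_set A =
    {z. \<exists>B. bounded_clinear B \<and>
      (\<forall>x. B (A x - z *\<^sub>C x) = x) \<and> (\<forall>x. A (B x) - z *\<^sub>C B x = x)}"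

text \<open>The \<open>+\<close> below is the elementwise (Minkowski) sum of sets.\<close>

definition is_direct_sum :: "'a::complex_normed_vector set \<Rightarrow> 'a set \<Rightarrow> bool"
  where "is_direct_sum S T \<longleftrightarrow> S + T = UNIV \<and> S \<inter> T = {0}"

definition unbounded_curve_from_0 :: "complex set \<Rightarrow> bool"
  where "unbounded_curve_from_0 C \<longleftrightarrow>
    (\<exists>\<gamma>::real \<Rightarrow> complex. continuous_on {0..} \<gamma> \<and> \<gamma> 0 = 0 \<and>
      C = \<gamma> ` {0..} \<and> \<not> bounded C)"

text \<open>Only meaningful for \<open>x \<noteq> 0\<close>.\<close>

definition sine_between :: "complex set \<Rightarrow> 'a::complex_normed_vector \<Rightarrow> 'a \<Rightarrow> real"
  where "sine_between C x y = (INF z\<in>C. norm (x - z *\<^sub>C y) / norm x)"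

text \<open>The zero operator is treated separately: the infimum over the empty set, which
  should be \<open>1\<close> here, is an unspecified real number in the library.\<close>

definition operator_sine :: "complex set \<Rightarrow> ('a::complex_normed_vector \<Rightarrow> 'a) \<Rightarrow> real"
  where "operator_sine C A =
    (if null_space A = UNIV then 1 else (INF x\<in>- null_space A. sine_between C (A x) x))"

text \<open>When the sine is \<open>1\<close> the angle is acute, i.e. in \<open>[0, \<pi>/2]\<close>; the only such
  angle having sine \<open>1\<close> is \<open>\<pi>/2\<close>.\<close>

definition operator_angle :: "complex set \<Rightarrow> ('a::complex_normed_vector \<Rightarrow> 'a) \<Rightarrow> real"
  where "operator_angle C A =
    (if operator_sine C A = 1 then pi / 2 else pi - arcsin (operator_sine C A))"

end

theory Submission
  imports Defs
begin

text \<open>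
  The angle condition says that \<open>c \<parallel>A x\<parallel> \<le> \<parallel>A x - z x\<parallel>\<close> for some \<open>c > 0\<close>, all \<open>x\<close> and all
  \<open>z \<in> C\<close>.

  If \<open>X = R(A) \<oplus> N(A)\<close>, the open mapping theorem shows that the projections are bounded, that
  \<open>R(A)\<close> is closed and that \<open>A\<close> is bounded below on \<open>R(A)\<close>. This gives the inequality for all
  small \<open>z\<close>. It also holds for \<open>\<bar>z\<bar>\<close> bounded away from \<open>\<parallel>A\<parallel>\<close> from above and on compact sets of
  \<open>z\<close> with \<open>A - z\<close> bounded below. So \<open>C\<close> may be a short segment from \<open>0\<close> to a point of the
  unbounded component, followed by a path to a large point and a ray to infinity.

  Conversely, the inequality at \<open>x = u - n / z\<close> gives \<open>c \<parallel>A u\<parallel> \<le> \<parallel>A u + n\<parallel>\<close> for \<open>n \<in> N(A)\<close> as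
  \<open>z \<rightarrow> 0\<close>; hence the sum \<open>R(A) + N(A)\<close> is direct and closed. Moreover \<open>A - z\<close> is bounded below
  for \<open>z \<in> C - {0}\<close>. Surjectivity of \<open>A - z\<close> is then locally constant in \<open>z\<close>, so it propagates
  from large \<open>z\<close> to \<open>z\<close> arbitrarily close to \<open>0\<close>. Solving \<open>A u - z u = y\<close> for small \<open>z\<close> gives
  \<open>A u\<close> bounded and \<open>A (z u)\<close> small, so \<open>z u\<close> is close to \<open>N(A)\<close> because \<open>R(A)\<close> is closed. Thus
  \<open>R(A) + N(A)\<close> is dense.
\<close>

section \<open>Open mapping and perturbation of surjectivity in Banach spaces\<close>

text \<open>Banach's argument: Baire category in the closed image, then successive approximation.
  The domain is a closed subspace \<open>S\<close> so that the lemma applies to \<open>R(A)\<close>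
  and to the product of \<open>X\<close> with \<open>N(A)\<close>, which are not types.\<close>

lemma open_mapping_closed_range:
  fixes f :: "'a::banach \<Rightarrow> 'b::banach"
  assumes f: "bounded_linear f" and S: "subspace S" "closed S" and cl: "closed (f ` S)"
  obtains K where "K > 0" "\<And>y. y \<in> f ` S \<Longrightarrow> \<exists>x\<in>S. f x = y \<and> norm x \<le> K * norm y"
proof -
  interpret bounded_linear f by (rule f)
  define G where "G = f ` S"
  define E where "E n = closure (f ` (S \<inter> cball 0 (real n)))" for n
  have subG: "subspace G"
    unfolding G_def by (rule linear_subspace_image[OF linear_axioms S(1)])
  have GE: "G \<subseteq> (\<Union>n. E n)"
  proof
    fix y assume "y \<in> G"
    then obtain x where x: "x \<in> S" "y = f x" by (auto simp: G_def)
    obtain n where "norm x \<le> real n" using real_arch_simple by blast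
    then have "y \<in> f ` (S \<inter> cball 0 (real n))" using x by auto
    then have "y \<in> E n" unfolding E_def by (rule subsetD[OF closure_subset])
    then show "y \<in> (\<Union>n. E n)" by blast
  qed
  \<comment> \<open>Otherwise the sets \<open>G - E n\<close> would be dense and relatively open in
    the complete space \<open>G\<close>, although their intersection is empty.\<close>
  have "\<exists>n. \<not> G \<subseteq> closure (G - E n)"
  proof (rule ccontr)
    assume "\<not> ?thesis"
    then have dense: "G \<subseteq> closure (G - E n)" for n by blast
    have "top_of_set G closure_of (\<Inter>(range (\<lambda>n. G - E n))) = topspace (top_of_set G)"
    proof (rule Baire_category)
      show "completely_metrizable_space (top_of_set G) \<or>
          locally_compact_space (top_of_set G) \<and> regular_space (top_of_set G)"
        using cl completely_metrizable_space_closedin[OF completely_metrizable_space_euclidean, of G]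
        by (simp add: G_def)
      show "countable (range (\<lambda>n. G - E n))" by simp
      fix T assume "T \<in> range (\<lambda>n. G - E n)"
      then obtain n where T: "T = G - E n" by blast
      have "T = G \<inter> - E n" using T by blast
      then have "openin (top_of_set G) T"
        by (simp add: E_def openin_open_Int open_Compl)
      moreover have "G \<inter> T = T" using T by blast
      ultimately show "openin (top_of_set G) T \<and>
          top_of_set G closure_of T = topspace (top_of_set G)"
        using dense[of n] T by (auto simp: closure_of_subtopology)
    qed
    moreover have "\<Inter>(range (\<lambda>n. G - E n)) = {}" using GE by blast
    ultimately have "topspace (top_of_set G) = {}" by (metis closure_of_empty)
    then have "G = {}" by simp
    then show False using subspace_0[OF subG] by blast
  qed
  then obtain n y0 where y0: "y0 \<in> G" "y0 \<notin> closure (G - E n)" by blast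
  then obtain r where r: "r > 0" "\<And>y. y \<in> G \<Longrightarrow> dist y y0 < r \<Longrightarrow> y \<in> E n"
    unfolding closure_approachable by blast
  define M where "M = 4 * real n / r"
  have M0: "M \<ge> 0" using r(1) by (simp add: M_def)
  \<comment> \<open>Subtracting an approximate preimage of \<open>y0\<close> from one of
    \<open>y0 + z\<close> moves the ball about \<open>y0\<close> to the origin and doubles the norm
    bound.\<close>
  have small: "\<exists>x\<in>S. norm x \<le> 2 * real n \<and> norm (z - f x) < e"
    if z: "z \<in> G" "norm z < r" and e: "e > 0" for z e
  proof -
    have approx: "\<exists>x\<in>S. norm x \<le> real n \<and> dist (f x) y < e'" if "y \<in> E n" "e' > 0" for y e'
      using that unfolding E_def closure_approachable by fastforce
    have "y0 + z \<in> E n" using r(2)[of "y0 + z"] subspace_add[OF subG y0(1) z(1)] z(2)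
      by (simp add: dist_norm)
    then obtain x1 where x1: "x1 \<in> S" "norm x1 \<le> real n" "dist (f x1) (y0 + z) < e/2"
      using approx[of "y0 + z" "e/2"] e by auto
    have "y0 \<in> E n" using r y0(1) by simp
    then obtain x2 where x2: "x2 \<in> S" "norm x2 \<le> real n" "dist (f x2) y0 < e/2"
      using approx[of y0 "e/2"] e by auto
    have "z - f (x1 - x2) = (f x2 - y0) - (f x1 - (y0 + z))"
      by (simp add: diff)
    also have "norm \<dots> \<le> norm (f x2 - y0) + norm (f x1 - (y0 + z))" by (rule norm_triangle_ineq4)
    also have "\<dots> < e" using x1(3) x2(3) by (simp add: dist_norm)
    finally have "norm (z - f (x1 - x2)) < e" .
    moreover have "norm (x1 - x2) \<le> 2 * real n"
      using norm_triangle_ineq4[of x1 x2] x1(2) x2(2) by linarith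
    ultimately show ?thesis using subspace_diff[OF S(1) x1(1) x2(1)] by blast
  qed
  have "\<exists>x\<in>S. norm x \<le> M * norm z \<and> norm (z - f x) \<le> norm z / 2" if z: "z \<in> G" for z
  proof (cases "z = 0")
    case True
    then show ?thesis using subspace_0[OF S(1)] by (intro bexI[of _ 0]) (auto simp: zero)
  next
    case False
    \<comment> \<open>Rescales \<open>z\<close> to norm \<open>r / 2\<close>, where
      \<open>small\<close> applies; scaling back turns \<open>2 * real n\<close> into
      \<open>M * norm z\<close>.\<close>
    define a where "a = r / (2 * norm z)"
    have a: "a > 0" using False r(1) by (simp add: a_def)
    have "norm (a *\<^sub>R z) < r" using False r(1) by (simp add: a_def)
    then obtain x where x: "x \<in> S" "norm x \<le> 2 * real n" "norm (a *\<^sub>R z - f x) < a * norm z / 2"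
      using small[of "a *\<^sub>R z" "a * norm z / 2"] subspace_scale[OF subG z] a False by auto
    have "norm (z - f (x /\<^sub>R a)) = norm ((a *\<^sub>R z - f x) /\<^sub>R a)"
      using a by (simp add: scale scaleR_diff_right)
    also have "\<dots> = norm (a *\<^sub>R z - f x) / a" using a by (simp add: divide_inverse_commute)
    also have "\<dots> \<le> norm z / 2" using x(3) a by (simp add: field_simps)
    finally have 1: "norm (z - f (x /\<^sub>R a)) \<le> norm z / 2" .
    have "norm (x /\<^sub>R a) = norm x / a" using a by (simp add: divide_inverse_commute)
    also have "\<dots> \<le> 2 * real n / a" using x(2) a by (simp add: divide_right_mono)
    also have "\<dots> = M * norm z" using False r(1) by (simp add: M_def a_def field_simps)
    finally show ?thesis using 1 subspace_scale[OF S(1) x(1)] by blast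
  qed
  then obtain h where h: "\<And>z. z \<in> G \<Longrightarrow> h z \<in> S"
    "\<And>z. z \<in> G \<Longrightarrow> norm (h z) \<le> M * norm z"
    "\<And>z. z \<in> G \<Longrightarrow> norm (z - f (h z)) \<le> norm z / 2"
    by metis
  \<comment> \<open>The geometric series gives the factor \<open>2 * M\<close>; adding 1 keeps the
    constant positive when \<open>M = 0\<close>.\<close>
  have "\<exists>x\<in>S. f x = y \<and> norm x \<le> (2 * M + 1) * norm y" if y: "y \<in> G" for y
  proof -
    \<comment> \<open>\<open>z k\<close> is the error left after \<open>k\<close> corrections. It at
      least halves in norm at each step, so the corrections \<open>u k\<close> are summable and
      their images telescope to \<open>y\<close>.\<close>
    define z where "z k = ((\<lambda>z. z - f (h z)) ^^ k) y" for k
    have z0: "z 0 = y" and zS: "z (Suc k) = z k - f (h (z k))" for k by (simp_all add: z_def)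
    have zG: "z k \<in> G" for k
    proof (induction k)
      case (Suc k)
      then have "f (h (z k)) \<in> G" using h(1) by (simp add: G_def)
      then show ?case using Suc subspace_diff[OF subG] by (simp add: zS)
    qed (simp add: z0 y)
    have zn: "norm (z k) \<le> norm y * (1/2)^k" for k
    proof (induction k)
      case (Suc k)
      then show ?case using h(3)[OF zG[of k]] by (simp add: zS)
    qed (simp add: z0)
    define u where "u k = h (z k)" for k
    have un: "norm (u k) \<le> M * norm y * (1/2)^k" for k
      using order_trans[OF h(2)[OF zG[of k]] mult_left_mono[OF zn[of k] M0]]
      by (simp add: u_def mult.assoc)
    have sg: "(\<lambda>k. M * norm y * (1/2)^k) sums (M * norm y * 2)"
      using sums_mult[OF geometric_sums[of "1/2::real"], of "M * norm y"] by simp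
    have su: "summable u"
      by (rule summable_comparison_test'[OF sums_summable[OF sg]]) (rule un)
    have sn: "summable (\<lambda>k. norm (u k))"
      by (rule summable_comparison_test'[OF sums_summable[OF sg]]) (simp add: un)
    have "norm (suminf u) \<le> (\<Sum>k. norm (u k))" by (rule summable_norm[OF sn])
    also have "\<dots> \<le> M * norm y * 2"
      using suminf_le[OF un sn sums_summable[OF sg]] sums_unique[OF sg] by simp
    also have "\<dots> \<le> (2 * M + 1) * norm y" by (simp add: algebra_simps)
    finally have nx: "norm (suminf u) \<le> (2 * M + 1) * norm y" .
    have inS: "suminf u \<in> S"
    proof (rule closed_sequentially[OF S(2)])
      show "(\<lambda>m. sum u {..<m}) \<longlonglongrightarrow> suminf u" using su by (rule summable_LIMSEQ)
      show "sum u {..<m} \<in> S" for m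
        using S(1) h(1)[OF zG] by (auto intro: subspace_sum simp: u_def)
    qed
    have "(\<lambda>k. f (u k)) sums f (suminf u)"
      by (rule sums[OF summable_sums[OF su]])
    moreover have "(\<lambda>k. f (u k)) sums y"
    proof -
      have "(\<lambda>k. norm y * (1/2)^k) \<longlonglongrightarrow> 0"
        by (intro tendsto_mult_right_zero LIMSEQ_power_zero) simp
      then have "z \<longlonglongrightarrow> 0"
        by (rule Lim_null_comparison[rotated]) (simp add: zn)
      then have "(\<lambda>k. z k - z (Suc k)) sums (z 0 - 0)" by (rule telescope_sums')
      then show ?thesis by (simp add: z0 zS u_def)
    qed
    ultimately have "f (suminf u) = y" by (rule sums_unique2)
    then show ?thesis using nx inS by blast
  qed
  then show ?thesis using that[of "2 * M + 1"] M0 by (simp add: G_def)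
qed

text \<open>Solving \<open>U x = y\<close> means finding a fixed point of \<open>x\<close> mapped to
  the \<open>T\<close>-preimage of \<open>y + (T x - U x)\<close>. The lower bound on
  \<open>T\<close> makes this map a contraction with factor \<open>d / c\<close>.\<close>

lemma surj_perturbation:
  fixes T U :: "'a::banach \<Rightarrow> 'a"
  assumes T: "bounded_linear T" "surj T" and U: "bounded_linear U"
    and below: "\<And>x. c * norm x \<le> norm (T x)"
    and near: "\<And>x. norm (T x - U x) \<le> d * norm x" and "0 \<le> d" "d < c"
  shows "surj U"
proof -
  interpret T: bounded_linear T by (rule T(1))
  interpret U: bounded_linear U by (rule U)
  have "\<exists>x. U x = y" for y
  proof -
    define g where "g x = inv T (y + (T x - U x))" for x
    have Tg: "T (g x) = y + (T x - U x)" for x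
      unfolding g_def by (rule surj_f_inv_f[OF T(2)])
    have "\<exists>!x. g x = x"
    proof (rule banach_fix_type[of "d / c"]; (intro allI)?)
      show "0 \<le> d / c" "d / c < 1" using assms by auto
      fix x x' :: 'a
      have "c * norm (g x - g x') \<le> norm (T (g x - g x'))" by (rule below)
      also have "T (g x - g x') = T (x - x') - U (x - x')"
        by (simp add: T.diff U.diff Tg)
      also have "norm \<dots> \<le> d * norm (x - x')" by (rule near)
      finally show "dist (g x) (g x') \<le> d / c * dist x x'"
        using assms by (simp add: dist_norm field_simps)
    qed
    then obtain x where "g x = x" by blast
    then have "U x = y" using Tg[of x] by simp
    then show ?thesis ..
  qed
  then show ?thesis by (metis surjI)
qed

section \<open>The angle condition as a norm inequality\<close>

lemma bounded_linear_scaleC: "bounded_linear (\<lambda>x::'a::complex_normed_vector. z *\<^sub>C x)"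
proof (rule bounded_linear_intro[of _ "cmod z"])
  show "z *\<^sub>C (r *\<^sub>R x) = r *\<^sub>R (z *\<^sub>C x)" for r and x :: 'a
    by (simp add: scaleC_of_real[symmetric] scaleC_scaleC mult.commute)
qed (simp_all add: scaleC_add_right norm_scaleC mult.commute)

lemma scaleC_zero_right: "z *\<^sub>C (0::'a::complex_normed_vector) = 0"
  by (rule linear_0[OF bounded_linear.linear[OF bounded_linear_scaleC]])

lemma scaleC_minus_left: "(- z) *\<^sub>C (x::'a::complex_normed_vector) = - (z *\<^sub>C x)"
  using scaleC_add_left[of "- z" z x] scaleC_of_real[of 0 x]
  by (simp add: eq_neg_iff_add_eq_0)

lemma scaleC_diff_left: "(a - b) *\<^sub>C (x::'a::complex_normed_vector) = a *\<^sub>C x - b *\<^sub>C x"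
  using scaleC_add_left[of a "- b" x] by (simp add: scaleC_minus_left)

lemma bounded_linear_minus_scaleC:
  "bounded_linear A \<Longrightarrow> bounded_linear (\<lambda>x::'a::complex_normed_vector. A x - z *\<^sub>C x)"
  by (intro bounded_linear_sub bounded_linear_scaleC)

text \<open>Since arcsin is positive on positive arguments up to 1, the angle reaches
  \<open>pi\<close> only when the sine is 0. A positive sine itself serves as \<open>c\<close>, and
  any such \<open>c\<close> is a lower bound for all the quotients.\<close>

lemma operator_angle_less_pi_iff:
  fixes A :: "'a::complex_normed_vector \<Rightarrow> 'a"
  assumes "0 \<in> C" and "bounded_linear A"
  shows "operator_angle C A < pi \<longleftrightarrow>
    (\<exists>c>0. \<forall>x. \<forall>z\<in>C. c * norm (A x) \<le> norm (A x - z *\<^sub>C x))"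
proof (cases "null_space A = UNIV")
  case True
  then have "A x = 0" for x by (auto simp: null_space_def)
  moreover have "operator_angle C A < pi"
    using True by (simp add: operator_angle_def operator_sine_def)
  ultimately show ?thesis by (auto intro!: exI[of _ "1::real"])
next
  case False
  define q where "q x z = norm (A x - z *\<^sub>C x) / norm (A x)" for x z
  define N where "N = - null_space A"
  have N: "N \<noteq> {}" and Nx: "x \<in> N \<longleftrightarrow> A x \<noteq> 0" for x
    using False by (auto simp: N_def null_space_def)
  have sb: "sine_between C (A x) x = (INF z\<in>C. q x z)" for x
    by (simp add: sine_between_def q_def)
  have bq: "bdd_below (q x ` C)" for x by (rule bdd_belowI[of _ 0]) (auto simp: q_def)
  have s0: "0 \<le> sine_between C (A x) x" for x
    unfolding sb using assms(1) by (intro cINF_greatest) (auto simp: q_def)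
  have sq: "sine_between C (A x) x \<le> q x z" if "z \<in> C" for x z
    unfolding sb using that by (intro cINF_lower bq)
  have os: "operator_sine C A = (INF x\<in>N. sine_between C (A x) x)"
    using False by (simp add: operator_sine_def N_def)
  have bs: "bdd_below ((\<lambda>x. sine_between C (A x) x) ` N)"
    by (rule bdd_belowI[of _ 0]) (auto simp: s0)
  have o0: "0 \<le> operator_sine C A" unfolding os by (intro cINF_greatest N s0)
  have ox: "operator_sine C A \<le> sine_between C (A x) x" if "x \<in> N" for x
    unfolding os using that by (intro cINF_lower bs)
  obtain x0 where x0: "x0 \<in> N" using N by blast
  \<comment> \<open>The point 0 of \<open>C\<close> keeps the sine at most 1, hence in the range
    where arcsin is increasing.\<close>
  have "q x0 0 = 1"
    using x0 norm_scaleC[of 0 x0] by (simp add: q_def Nx)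
  then have o1: "operator_sine C A \<le> 1"
    using ox[OF x0] sq[OF assms(1), of x0] by simp
  have "operator_angle C A < pi \<longleftrightarrow> operator_sine C A > 0"
  proof (cases "operator_sine C A = 0")
    case False
    then have "0 < arcsin (operator_sine C A)" using arcsin_less_arcsin[of 0] o0 o1 by simp
    then show ?thesis using o0 False by (simp add: operator_angle_def)
  qed (simp add: operator_angle_def)
  also have "\<dots> \<longleftrightarrow> (\<exists>c>0. \<forall>x. \<forall>z\<in>C. c * norm (A x) \<le> norm (A x - z *\<^sub>C x))"
  proof
    assume pos: "operator_sine C A > 0"
    have "operator_sine C A * norm (A x) \<le> norm (A x - z *\<^sub>C x)" if "z \<in> C" for x z
    proof (cases "A x = 0")
      case nz: False
      then have "operator_sine C A \<le> q x z" using ox[of x] sq[OF that, of x] by (simp add: Nx)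
      then show ?thesis using nz by (simp add: q_def field_simps)
    qed simp
    with pos show "\<exists>c>0. \<forall>x. \<forall>z\<in>C. c * norm (A x) \<le> norm (A x - z *\<^sub>C x)" by blast
  next
    assume "\<exists>c>0. \<forall>x. \<forall>z\<in>C. c * norm (A x) \<le> norm (A x - z *\<^sub>C x)"
    then obtain c where c: "c > 0" "\<And>x z. z \<in> C \<Longrightarrow> c * norm (A x) \<le> norm (A x - z *\<^sub>C x)"
      by blast
    have "c \<le> q x z" if "x \<in> N" "z \<in> C" for x z
      using c(2)[OF that(2), of x] that(1) by (simp add: q_def Nx field_simps)
    then have "c \<le> operator_sine C A"
      unfolding os sb using N assms(1) by (intro cINF_greatest) auto
    with c(1) show "operator_sine C A > 0" by simp
  qed
  finally show ?thesis .
qed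

section \<open>From the direct sum to closed range and a suitable curve\<close>

lemma direct_sum_range_null_space:
  assumes "is_direct_sum (range A) (null_space A)"
  shows "\<exists>x n. A n = 0 \<and> y = A x + n" and "A (A x) = 0 \<Longrightarrow> A x = 0"
proof -
  have "y \<in> range A + null_space A" using assms by (simp add: is_direct_sum_def)
  then show "\<exists>x n. A n = 0 \<and> y = A x + n" by (auto simp: null_space_def elim!: set_plus_elim)
  show "A (A x) = 0 \<Longrightarrow> A x = 0"
    using assms by (auto simp: is_direct_sum_def null_space_def)
qed

text \<open>A bounded projection onto \<open>N(A)\<close> along \<open>R(A)\<close> vanishes at
  limits of points of \<open>R(A)\<close>, and it makes the complementary projection bounded
  too.\<close>

lemma direct_sum_imp_closed_range:
  fixes A :: "'a::complex_banach \<Rightarrow> 'a"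
  assumes A: "bounded_linear A" and ds: "is_direct_sum (range A) (null_space A)"
  shows "closed (range A)"
    and "\<exists>k>0. \<forall>x n. A n = 0 \<longrightarrow> k * norm (A x) \<le> norm (A x + n)"
proof -
  interpret bounded_linear A by (rule A)
  note span = direct_sum_range_null_space(1)[OF ds] and disj = direct_sum_range_null_space(2)[OF ds]
  \<comment> \<open>\<open>f\<close> determines \<open>A x\<close> and \<open>n\<close> from \<open>A x + n\<close>, so the open mapping theorem bounds the projection onto \<open>N(A)\<close>.\<close>
  define f where "f p = A (fst p) + snd p" for p :: "'a \<times> 'a"
  define S where "S = (UNIV::'a set) \<times> {x. A x = 0}"
  have clN: "closed {x. A x = 0}"
    by (intro closed_Collect_eq continuous_intros linear_continuous_on A)
  have f: "bounded_linear f" unfolding f_def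
    by (intro bounded_linear_add bounded_linear_compose[OF A] bounded_linear_fst bounded_linear_snd)
  have S: "subspace S" "closed S"
    unfolding S_def by (auto intro!: closed_Times clN simp: subspace_def add scale zero zero_prod_def)
  have fS: "f ` S = UNIV"
  proof -
    have "y \<in> f ` S" for y
    proof -
      obtain x n where "A n = 0" "y = A x + n" using span by blast
      then show ?thesis by (intro image_eqI[of _ _ "(x, n)"]) (auto simp: f_def S_def)
    qed
    then show ?thesis by blast
  qed
  obtain K where K: "K > 0" "\<And>y. \<exists>p\<in>S. f p = y \<and> norm p \<le> K * norm y"
    using open_mapping_closed_range[OF f S] fS by (metis UNIV_I closed_UNIV)
  have nb: "norm n \<le> K * norm (A x + n)" if n: "A n = 0" for x n
  proof -
    obtain p where p: "p \<in> S" "f p = A x + n" "norm p \<le> K * norm (A x + n)" using K(2) by blast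
    \<comment> \<open>Two decompositions of the same point differ by a vector in both
      \<open>R(A)\<close> and \<open>N(A)\<close>, which must be 0.\<close>
    have *: "A (fst p - x) = n - snd p" using p(2) by (simp add: f_def diff algebra_simps)
    have "A (A (fst p - x)) = 0" unfolding * using p(1) n by (auto simp: S_def diff)
    then have "snd p = n" using disj * by fastforce
    then show ?thesis using p(3) norm_snd_le[of "snd p" "fst p"] unfolding prod.collapse by simp
  qed
  show "closed (range A)"
    unfolding closed_sequential_limits
  proof (intro allI impI, elim conjE)
    fix s l assume s: "\<forall>n. s n \<in> range A" "s \<longlonglongrightarrow> l"
    obtain x n where xn: "A n = 0" "l = A x + n" using span by blast
    \<comment> \<open>\<open>l - s k\<close> has the same component \<open>n\<close> in
      \<open>N(A)\<close> as \<open>l\<close>, because \<open>s k\<close> lies in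
      \<open>R(A)\<close>.\<close>
    have "norm n \<le> K * norm (l - s k)" for k
    proof -
      obtain w where "s k = A w" using s(1) by blast
      then show ?thesis using nb[OF xn(1), of "x - w"] by (simp add: xn(2) diff algebra_simps)
    qed
    moreover have "(\<lambda>k. K * norm (l - s k)) \<longlonglongrightarrow> K * norm (l - l)"
      by (intro tendsto_intros s)
    ultimately have "norm n \<le> K * norm (l - l)"
      by (intro LIMSEQ_le_const) auto
    then show "l \<in> range A" using xn by simp
  qed
  show "\<exists>k>0. \<forall>x n. A n = 0 \<longrightarrow> k * norm (A x) \<le> norm (A x + n)"
  proof (intro exI[of _ "1 / (1 + K)"] conjI allI impI)
    show "1 / (1 + K) > 0" using K(1) by simp
    fix x n assume "A n = 0"
    then have "norm (A x) \<le> norm (A x + n) + K * norm (A x + n)"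
      using nb[of n x] norm_triangle_ineq4[of "A x + n" n] by simp
    then show "1 / (1 + K) * norm (A x) \<le> norm (A x + n)"
      using K(1) by (simp add: field_simps)
  qed
qed

text \<open>\<open>A\<close> maps \<open>R(A)\<close> bijectively onto itself, so it is bounded
  below there by \<open>1 / K\<close>, and subtracting a small multiple of the identity loses at
  most half of that. The component in \<open>N(A)\<close> is handled by \<open>k\<close>.\<close>

lemma direct_sum_imp_bound_near_0:
  fixes A :: "'a::complex_banach \<Rightarrow> 'a"
  assumes A: "bounded_clinear A" and ds: "is_direct_sum (range A) (null_space A)"
  obtains c d where "c > 0" "d > 0"
    "\<And>x z. cmod z \<le> d \<Longrightarrow> c * norm (A x) \<le> norm (A x - z *\<^sub>C x)"
proof -
  have bl: "bounded_linear A" and AC: "A (z *\<^sub>C x) = z *\<^sub>C A x" for z x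
    using A by (auto simp: bounded_clinear_def)
  interpret bounded_linear A by (rule bl)
  obtain k where k: "k > 0" "\<And>x n. A n = 0 \<Longrightarrow> k * norm (A x) \<le> norm (A x + n)"
    using direct_sum_imp_closed_range(2)[OF bl ds] by blast
  note span = direct_sum_range_null_space(1)[OF ds] and disj = direct_sum_range_null_space(2)[OF ds]
  have img: "A ` range A = range A"
  proof -
    have "A y \<in> A ` range A" for y
    proof -
      obtain u n where "A n = 0" "y = A u + n" using span by blast
      then show ?thesis by (simp add: add)
    qed
    then show ?thesis by blast
  qed
  have "subspace (range A)"
    by (simp add: linear_subspace_image linear_axioms)
  then obtain K where K: "K > 0" "\<And>y. y \<in> range A \<Longrightarrow> \<exists>x\<in>range A. A x = y \<and> norm x \<le> K * norm y"
    using open_mapping_closed_range[OF bl, of "range A"] direct_sum_imp_closed_range(1)[OF bl ds] img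
    by metis
  have below: "norm (A u) \<le> K * norm (A (A u))" for u
  proof -
    obtain w where w: "A (A w) = A (A u)" "norm (A w) \<le> K * norm (A (A u))"
      using K(2)[of "A (A u)"] by blast
    have "A (A (w - u)) = 0" using w(1) by (simp add: diff)
    then have "A w = A u" using disj[of "w - u"] by (simp add: diff)
    then show ?thesis using w(2) by simp
  qed
  show ?thesis
  proof (rule that[of "k / 2" "1 / (2 * K)"])
    show "k / 2 > 0" "1 / (2 * K) > 0" using k K by auto
    fix x z assume z: "cmod z \<le> 1 / (2 * K)"
    obtain u n where un: "A n = 0" "x = A u + n" using span by blast
    have "cmod z * norm (A u) \<le> 1 / (2 * K) * (K * norm (A (A u)))"
      using z below[of u] K(1) by (intro mult_mono) auto
    also have "\<dots> = norm (A (A u)) / 2" using K(1) by simp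
    finally have "norm (A (A u)) / 2 \<le> norm (A (A u)) - norm (z *\<^sub>C A u)"
      by (simp add: norm_scaleC)
    also have "\<dots> \<le> norm (A (A u - z *\<^sub>C u))"
      by (simp add: diff AC norm_triangle_ineq2)
    finally have "k / 2 * norm (A (A u)) \<le> k * norm (A (A u - z *\<^sub>C u))"
      using k(1) by simp
    \<comment> \<open>For \<open>x = A u + n\<close> the vector \<open>A x - z x\<close> splits into
      \<open>A (A u - z u)\<close> in \<open>R(A)\<close> and \<open>- z n\<close> in
      \<open>N(A)\<close>.\<close>
    also have "\<dots> \<le> norm (A (A u - z *\<^sub>C u) + (- z) *\<^sub>C n)"
      using un(1) by (intro k(2)) (simp add: AC scaleC_zero_right)
    also have "A (A u - z *\<^sub>C u) + (- z) *\<^sub>C n = A x - z *\<^sub>C x"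
      using un by (simp add: diff add AC scaleC_add_right scaleC_minus_left)
    finally show "k / 2 * norm (A x) \<le> norm (A x - z *\<^sub>C x)" using un by (simp add: add)
  qed
qed

text \<open>A lower bound \<open>c\<close> at \<open>z\<close> persists as \<open>c / 2\<close> at
  all points closer than \<open>c / 2\<close>; a finite subcover makes the bound uniform on compact
  sets.\<close>

lemma open_bounded_below:
  fixes A :: "'a::complex_normed_vector \<Rightarrow> 'a"
  shows "open {z. \<exists>c>0. \<forall>x. c * norm x \<le> norm (A x - z *\<^sub>C x)}" (is "open ?G")
    and "compact P \<Longrightarrow> P \<subseteq> {z. \<exists>c>0. \<forall>x. c * norm x \<le> norm (A x - z *\<^sub>C x)} \<Longrightarrow>
      \<exists>c>0. \<forall>z\<in>P. \<forall>x. c * norm x \<le> norm (A x - z *\<^sub>C x)"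
proof -
  have near: "c / 2 * norm x \<le> norm (A x - w *\<^sub>C x)"
    if "\<And>x. c * norm x \<le> norm (A x - z *\<^sub>C x)" "dist z w < c / 2" for c z w x
  proof -
    have "norm ((z - w) *\<^sub>C x) \<le> c / 2 * norm x"
      using that(2) unfolding norm_scaleC dist_norm by (intro mult_right_mono) auto
    moreover have "norm (A x - z *\<^sub>C x) \<le> norm (A x - w *\<^sub>C x) + norm ((z - w) *\<^sub>C x)"
      using norm_triangle_ineq4[of "A x - w *\<^sub>C x" "(z - w) *\<^sub>C x"]
      by (simp add: scaleC_diff_left)
    moreover have "c * norm x = c / 2 * norm x + c / 2 * norm x" by simp
    ultimately show ?thesis using that(1)[of x] by linarith
  qed
  show "open ?G"
  proof (rule openI)
    fix z assume "z \<in> ?G"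
    then obtain c where c: "c > 0" "\<And>x. c * norm x \<le> norm (A x - z *\<^sub>C x)" by blast
    have "ball z (c / 2) \<subseteq> ?G"
      using near[OF c(2)] c(1) by (auto intro!: exI[of _ "c / 2"])
    then show "\<exists>e>0. ball z e \<subseteq> ?G" using c(1) by (intro exI[of _ "c / 2"]) auto
  qed
  assume P: "compact P" "P \<subseteq> ?G"
  then have "\<forall>z\<in>P. \<exists>c>0. \<forall>x. c * norm x \<le> norm (A x - z *\<^sub>C x)" by blast
  then obtain c where c: "\<And>z. z \<in> P \<Longrightarrow> c z > 0"
    "\<And>z x. z \<in> P \<Longrightarrow> c z * norm x \<le> norm (A x - z *\<^sub>C x)"
    by metis
  obtain F where F: "F \<subseteq> P" "finite F" "P \<subseteq> (\<Union>z\<in>F. ball z (c z / 2))"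
  proof (rule compactE_image[OF P(1)])
    show "open (ball z (c z / 2))" for z by simp
    show "P \<subseteq> (\<Union>z\<in>P. ball z (c z / 2))" using c(1) by fastforce
  qed blast
  \<comment> \<open>Inserting 1 keeps the minimum meaningful when \<open>F\<close> is empty.\<close>
  define m where "m = Min (insert 1 ((\<lambda>z. c z / 2) ` F))"
  have "m > 0" using F c(1) by (auto simp: m_def)
  moreover have "m * norm x \<le> norm (A x - w *\<^sub>C x)" if w: "w \<in> P" for w x
  proof -
    obtain z where z: "z \<in> F" "dist z w < c z / 2" using F(3) w by auto
    have "m \<le> c z / 2" unfolding m_def using F(2) z(1) by (intro Min_le) auto
    then have "m * norm x \<le> c z / 2 * norm x" by (rule mult_right_mono) simp
    also have "\<dots> \<le> norm (A x - w *\<^sub>C x)"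
      using near[of "c z" z w x] c(2) F(1) z by blast
    finally show ?thesis .
  qed
  ultimately show "\<exists>c>0. \<forall>z\<in>P. \<forall>x. c * norm x \<le> norm (A x - z *\<^sub>C x)" by blast
qed

lemma resolvent_set_bounded_below:
  assumes "z \<in> resolvent_set A"
  shows "\<exists>c>0. \<forall>x. c * norm x \<le> norm (A x - z *\<^sub>C x)"
proof -
  obtain B where B: "bounded_clinear B" "\<And>x. B (A x - z *\<^sub>C x) = x"
    using assms by (auto simp: resolvent_set_def)
  obtain K where K: "K > 0" "\<And>x. norm (B x) \<le> norm x * K"
    using bounded_linear.pos_bounded[of B] B(1) by (auto simp: bounded_clinear_def)
  have "1 / K * norm x \<le> norm (A x - z *\<^sub>C x)" for x
    using K(2)[of "A x - z *\<^sub>C x"] K(1) by (simp add: B(2) field_simps)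
  then show ?thesis using K(1) by (intro exI[of _ "1 / K"]) auto
qed

text \<open>Components of the open set \<open>G\<close> are path connected, so \<open>z0\<close> and
  \<open>z1\<close> can be joined inside \<open>G\<close>. A segment from 0 and a ray to infinity,
  which may leave \<open>G\<close>, complete the curve.\<close>

lemma unbounded_curve_through_component:
  assumes G: "open G" and D: "connected D" "D \<subseteq> G" and z: "z0 \<in> D" "z1 \<in> D" and "z1 \<noteq> 0"
  obtains C P where "unbounded_curve_from_0 C" "compact P" "P \<subseteq> G"
    "C \<subseteq> closed_segment 0 z0 \<union> P \<union> {z. cmod z1 \<le> cmod z}"
proof -
  obtain D' where D': "D' \<in> components G" "D \<subseteq> D'"
    using exists_component_superset[OF D(2) _ D(1)] z D by blast
  have "path_connected D'"
    using D' G open_components in_components_connected connected_open_path_connected by metis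
  then obtain p where p: "path p" "path_image p \<subseteq> D'" "pathstart p = z0" "pathfinish p = z1"
    using z D'(2) unfolding path_connected_def by blast
  define g where "g = linepath 0 z0 +++ p"
  have g: "path g" "pathstart g = 0" "pathfinish g = z1"
    "path_image g = closed_segment 0 z0 \<union> path_image p"
    using p by (auto simp: g_def path_image_join)
  define \<gamma> where "\<gamma> t = (if t \<le> 1 then g t else t *\<^sub>R z1)" for t
  have "continuous_on {0..} \<gamma>" unfolding \<gamma>_def
  proof (rule continuous_on_cases_1)
    have "{t \<in> {0..}. t \<le> 1} = {0..1::real}" by auto
    then show "continuous_on {t \<in> {0..}. t \<le> 1} g" using g(1) by (simp add: path_def)
    show "continuous_on {t \<in> {0..}. 1 \<le> t} (\<lambda>t. t *\<^sub>R z1)" by (intro continuous_intros)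
    show "g 1 = 1 *\<^sub>R z1" using g(3) by (simp add: pathfinish_def)
  qed
  moreover have "\<gamma> 0 = 0" using g(2) by (simp add: \<gamma>_def pathstart_def)
  moreover have "\<not> bounded (\<gamma> ` {0..})"
  proof
    assume "bounded (\<gamma> ` {0..})"
    then obtain b where b: "\<And>t. t \<ge> 0 \<Longrightarrow> norm (\<gamma> t) \<le> b" by (auto simp: bounded_iff)
    \<comment> \<open>The 2 puts \<open>t\<close> on the ray; the quotient pushes the norm beyond
      \<open>b\<close>.\<close>
    define t where "t = max 2 ((b + 1) / cmod z1)"
    have "b + 1 \<le> t * cmod z1"
      using assms(6) by (simp add: t_def pos_divide_le_eq[symmetric])
    moreover have "norm (\<gamma> t) = t * cmod z1" by (simp add: \<gamma>_def t_def)
    ultimately show False using b[of t] max.cobounded1[of 2 "(b + 1) / cmod z1"]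
      unfolding t_def[symmetric] by linarith
  qed
  ultimately have "unbounded_curve_from_0 (\<gamma> ` {0..})"
    unfolding unbounded_curve_from_0_def by blast
  moreover have "\<gamma> ` {0..} \<subseteq> closed_segment 0 z0 \<union> path_image p \<union> {z. cmod z1 \<le> cmod z}"
  proof -
    have "\<gamma> t \<in> closed_segment 0 z0 \<union> path_image p \<union> {z. cmod z1 \<le> cmod z}" if "t \<ge> 0" for t
    proof (cases "t \<le> 1")
      case True
      then have "\<gamma> t \<in> path_image g" using that by (auto simp: \<gamma>_def path_image_def)
      then show ?thesis using g(4) by blast
    next
      case False
      then show ?thesis
        using mult_right_mono[of 1 t "cmod z1"] by (simp add: \<gamma>_def)
    qed
    then show ?thesis by blast
  qed
  ultimately show ?thesis
    using that compact_path_image[OF p(1)] p(2) in_components_subset[OF D'(1)] by blast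
qed

lemma direct_sum_imp_angle:
  fixes A :: "'a::complex_banach \<Rightarrow> 'a"
  assumes A: "bounded_clinear A" and D: "connected D" "D \<subseteq> resolvent_set A" "\<not> bounded D"
    and "0 \<in> closure D" and ds: "is_direct_sum (range A) (null_space A)"
  obtains C c where "unbounded_curve_from_0 C" "c > 0"
    "\<And>x z. z \<in> C \<Longrightarrow> c * norm (A x) \<le> norm (A x - z *\<^sub>C x)"
proof -
  have bl: "bounded_linear A" using A by (simp add: bounded_clinear_def)
  obtain K where K: "K > 0" "\<And>x. norm (A x) \<le> norm x * K"
    using bounded_linear.pos_bounded[OF bl] by auto
  obtain c d where cd: "c > 0" "d > 0"
    "\<And>x z. cmod z \<le> d \<Longrightarrow> c * norm (A x) \<le> norm (A x - z *\<^sub>C x)"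
    using direct_sum_imp_bound_near_0[OF A ds] by blast
  obtain z0 where z0: "z0 \<in> D" "cmod z0 < d"
    using assms(5) cd(2) by (auto simp: closure_approachable)
  \<comment> \<open>Beyond the norm bound \<open>K\<close>, \<open>A - z\<close> is bounded below by
    \<open>cmod z - K\<close>, which takes care of the whole ray from \<open>z1\<close>.\<close>
  obtain z1 where z1: "z1 \<in> D" "cmod z1 > K"
    using D(3) by (force simp: bounded_iff not_le)
  define G where "G = {z. \<exists>c>0. \<forall>x. c * norm x \<le> norm (A x - z *\<^sub>C x)}"
  have DG: "D \<subseteq> G" using D(2) resolvent_set_bounded_below by (auto simp: G_def)
  have "z1 \<noteq> 0" using z1(2) K(1) by auto
  then obtain C P where CP: "unbounded_curve_from_0 C" "compact P" "P \<subseteq> G"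
    "C \<subseteq> closed_segment 0 z0 \<union> P \<union> {z. cmod z1 \<le> cmod z}"
    using unbounded_curve_through_component[OF _ D(1) DG z0(1) z1(1)]
      open_bounded_below(1)[of A, folded G_def] by blast
  obtain m where m: "m > 0" "\<And>z x. z \<in> P \<Longrightarrow> m * norm x \<le> norm (A x - z *\<^sub>C x)"
    using open_bounded_below(2)[OF CP(2) CP(3)[unfolded G_def]] by blast
  \<comment> \<open>One term for each piece of the curve; dividing by \<open>K\<close> turns bounds
    by \<open>norm x\<close> into bounds by \<open>norm (A x)\<close>.\<close>
  define c' where "c' = min c (min (m / K) ((cmod z1 - K) / K))"
  have "c' > 0" using cd(1) m(1) K(1) z1(2) by (simp add: c'_def)
  moreover have "c' * norm (A x) \<le> norm (A x - z *\<^sub>C x)" if "z \<in> C" for z x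
  proof -
    have by_norm: "c' * norm (A x) \<le> norm (A x - z *\<^sub>C x)"
      if "c' \<le> b / K" "b * norm x \<le> norm (A x - z *\<^sub>C x)" for b
    proof -
      have "c' * norm (A x) \<le> (b / K) * (norm x * K)"
        using that(1) K \<open>c' > 0\<close> by (intro mult_mono) auto
      then show ?thesis using that(2) K(1) by simp
    qed
    consider "z \<in> closed_segment 0 z0" | "z \<in> P" | "cmod z1 \<le> cmod z" using CP(4) \<open>z \<in> C\<close> by blast
    then show ?thesis
    proof cases
      case 1
      then have "cmod z \<le> d" using segment_bound(1)[of z 0 z0] z0(2) by simp
      then have "c * norm (A x) \<le> norm (A x - z *\<^sub>C x)" by (rule cd(3))
      moreover have "c' * norm (A x) \<le> c * norm (A x)" by (rule mult_right_mono) (auto simp: c'_def)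
      ultimately show ?thesis by simp
    next
      case 2
      then show ?thesis using m(2) by (intro by_norm[of m]) (auto simp: c'_def)
    next
      case 3
      have "cmod z1 * norm x \<le> norm (z *\<^sub>C x)"
        unfolding norm_scaleC using 3 by (rule mult_right_mono) simp
      then have "(cmod z1 - K) * norm x \<le> norm (z *\<^sub>C x) - norm (A x)"
        using K(2)[of x] by (simp add: algebra_simps)
      also have "\<dots> \<le> norm (A x - z *\<^sub>C x)" by (metis norm_minus_commute norm_triangle_ineq2)
      finally show ?thesis by (intro by_norm[of "cmod z1 - K"]) (auto simp: c'_def)
    qed
  qed
  ultimately show ?thesis using that CP(1) by blast
qed

section \<open>From the angle condition to the direct sum\<close>

text \<open>Provides the set along which surjectivity is propagated from a large point towards 0;
  \<open>C - {0}\<close> itself may be disconnected.\<close>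

lemma unbounded_curve_excursion:
  assumes "unbounded_curve_from_0 C"
  obtains E z where "connected E" "E \<subseteq> C - {0}" "0 \<in> closure E" "z \<in> E" "cmod z > K"
proof -
  obtain \<gamma> :: "real \<Rightarrow> complex" where \<gamma>: "continuous_on {0..} \<gamma>" "\<gamma> 0 = 0" "C = \<gamma> ` {0..}" "\<not> bounded C"
    using assms unfolding unbounded_curve_from_0_def by blast
  \<comment> \<open>The maximum ensures that the curve is not at 0 at time \<open>t\<close>, even
    for negative \<open>K\<close>.\<close>
  obtain t where t: "t \<ge> 0" "cmod (\<gamma> t) > max K 0"
    using \<gamma>(4) unfolding \<gamma>(3) bounded_iff not_ex not_all not_le
    by (metis atLeast_iff imageE not_le)
  \<comment> \<open>The curve may return to \<open>0\<close>; keep only the part after its last zero before time \<open>t\<close>.\<close>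
  define Z where "Z = {u \<in> {0..t}. \<gamma> u = 0}"
  have "continuous_on {0..t} \<gamma>" using \<gamma>(1) by (rule continuous_on_subset) auto
  then have "closed Z" unfolding Z_def
    by (intro continuous_closed_preimage_constant) auto
  moreover have "bounded Z" by (rule bounded_subset[of "{0..t}"]) (auto simp: Z_def)
  moreover have "0 \<in> Z" using t \<gamma>(2) by (simp add: Z_def)
  ultimately obtain s where s: "s \<in> Z" "\<And>u. u \<in> Z \<Longrightarrow> u \<le> s"
    using compact_attains_sup[of Z] compact_eq_bounded_closed by blast
  have st: "0 \<le> s" "s < t" "\<gamma> s = 0" using s(1) t(2) by (auto simp: Z_def less_le)
  show ?thesis
  proof (rule that[of "\<gamma> ` {s<..t}" "\<gamma> t"])
    have "continuous_on {s<..t} \<gamma>" using \<gamma>(1) by (rule continuous_on_subset) (use st in auto)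
    then show "connected (\<gamma> ` {s<..t})" by (intro connected_continuous_image connected_Ioc)
    show "\<gamma> ` {s<..t} \<subseteq> C - {0}"
    proof -
      have "\<gamma> u \<noteq> 0" if "u \<in> {s<..t}" for u
        using s(2)[of u] st(1) that by (auto simp: Z_def)
      then show ?thesis using st(1) unfolding \<gamma>(3) by fastforce
    qed
    show "\<gamma> t \<in> \<gamma> ` {s<..t}" "cmod (\<gamma> t) > K" using st t by auto
    show "0 \<in> closure (\<gamma> ` {s<..t})"
      unfolding closure_approachable
    proof (intro allI impI)
      fix e :: real assume "e > 0"
      then obtain d where d: "d > 0" "\<And>u. u \<ge> 0 \<Longrightarrow> dist u s < d \<Longrightarrow> dist (\<gamma> u) (\<gamma> s) < e"
        using \<gamma>(1) st(1) unfolding continuous_on_iff by (metis atLeast_iff)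
      define u where "u = min t (s + d / 2)"
      have "u \<in> {s<..t}" "dist u s < d" using d(1) st by (auto simp: u_def dist_real_def)
      moreover have "dist (\<gamma> u) 0 < e" using d(2)[of u] calculation st(1,3) by simp
      ultimately show "\<exists>w\<in>\<gamma> ` {s<..t}. dist w 0 < e" by blast
    qed
  qed
qed

text \<open>The angle inequality bounds \<open>A - z\<close> below by a multiple of
  \<open>cmod z\<close>, so by perturbation surjectivity is locally constant on \<open>E\<close>. At
  \<open>z1\<close> it follows by comparison with multiplication by \<open>- z1\<close>.\<close>

lemma angle_imp_surj:
  fixes A :: "'a::complex_banach \<Rightarrow> 'a"
  assumes bl: "bounded_linear A" and E: "connected E" "0 \<notin> E" and z1: "z1 \<in> E" "cmod z1 > K"
    and K: "K \<ge> 0" "\<And>x. norm (A x) \<le> K * norm x"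
    and c: "c > 0" "\<And>x z. z \<in> E \<Longrightarrow> c * norm (A x) \<le> norm (A x - z *\<^sub>C x)"
    and z: "z \<in> E"
  shows "surj (\<lambda>x. A x - z *\<^sub>C x)"
proof -
  define T where "T z = (\<lambda>x. A x - z *\<^sub>C x)" for z
  have T: "bounded_linear (T z)" for z
    unfolding T_def by (rule bounded_linear_minus_scaleC[OF bl])
  \<comment> \<open>For \<open>z\<close> in \<open>E\<close>, combine
    \<open>cmod z * norm x \<le> norm (A x) + norm (T z x)\<close> with
    \<open>c * norm (A x) \<le> norm (T z x)\<close>.\<close>
  define q where "q = c / (1 + c)"
  have q: "0 < q" "q < 1" using c(1) by (auto simp: q_def)
  have below: "q * cmod z * norm x \<le> norm (T z x)" if "z \<in> E" for z x
  proof -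
    have "norm (z *\<^sub>C x) \<le> norm (A x) + norm (T z x)"
      using norm_triangle_ineq4[of "A x" "T z x"] by (simp add: T_def)
    then have "c * (cmod z * norm x) \<le> c * norm (A x) + c * norm (T z x)"
      using c(1) by (simp add: norm_scaleC flip: distrib_left)
    also have "\<dots> \<le> norm (T z x) + c * norm (T z x)" using c(2)[OF that] by (simp add: T_def)
    finally show ?thesis using c(1) by (simp add: q_def field_simps)
  qed
  have near: "surj (T w)" if "surj (T z)" "z \<in> E" "cmod (w - z) < q * cmod z" for w z
  proof (rule surj_perturbation[OF T that(1) T below[OF that(2)] _ norm_ge_zero that(3)])
    show "norm (T z x - T w x) \<le> cmod (w - z) * norm x" for x
      by (simp add: T_def norm_scaleC scaleC_diff_left flip: norm_scaleC)
  qed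
  have "surj (T z) = surj (T z1)"
  proof (rule connected_local_const[OF E(1) z z1(1)], intro ballI)
    fix a assume a: "a \<in> E"
    then have "a \<noteq> 0" using E(2) by blast
    show "\<forall>\<^sub>F b in at a within E. surj (T a) = surj (T b)"
      unfolding eventually_at
    proof (intro exI[of _ "q * cmod a / 2"] conjI ballI impI)
      \<comment> \<open>With half the perturbation radius, \<open>cmod b\<close> is at least
        \<open>cmod a / 2\<close>, so each of \<open>a\<close> and \<open>b\<close> lies within the
        radius of the other and surjectivity passes both ways.\<close>
      show pos: "0 < q * cmod a / 2" using q \<open>a \<noteq> 0\<close> by simp
      fix b assume b: "b \<in> E" "b \<noteq> a \<and> dist b a < q * cmod a / 2"
      have "q * cmod a \<le> cmod a" using q by (simp add: mult_left_le_one_le)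
      then have "cmod a / 2 \<le> cmod b"
        using norm_triangle_ineq2[of a b] b(2) norm_minus_commute[of a b] by (simp add: dist_norm)
      then have "q * (cmod a / 2) \<le> q * cmod b" using q by (intro mult_left_mono) auto
      then have "cmod (b - a) < q * cmod a" "cmod (a - b) < q * cmod b"
        using b(2) pos by (auto simp: dist_norm norm_minus_commute)
      then show "surj (T a) = surj (T b)" using near a b(1) by blast
    qed
  qed
  also have "surj (T z1)"
  proof (rule surj_perturbation[OF bounded_linear_scaleC[of "- z1"] _ T _ _ K(1) z1(2)])
    have "z1 \<noteq> 0" using z1(1) E(2) by blast
    then have "(- z1) *\<^sub>C (- inverse z1) *\<^sub>C y = y" for y :: 'a
      using scaleC_of_real[of 1 y] by (simp add: scaleC_scaleC)
    then show "surj (\<lambda>x::'a. (- z1) *\<^sub>C x)" by (rule surjI)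
    show "cmod z1 * norm x \<le> norm ((- z1) *\<^sub>C x)" for x :: 'a by (simp add: norm_scaleC)
    show "norm ((- z1) *\<^sub>C x - T z1 x) \<le> K * norm x" for x
      using K(2)[of x] by (simp add: T_def scaleC_minus_left)
  qed
  finally show ?thesis by (simp add: T_def)
qed

lemma angle_imp_direct_sum:
  fixes A :: "'a::complex_banach \<Rightarrow> 'a"
  assumes A: "bounded_clinear A" and cl: "closed (range A)" and C: "unbounded_curve_from_0 C"
    and c: "c > 0" "\<And>x z. z \<in> C \<Longrightarrow> c * norm (A x) \<le> norm (A x - z *\<^sub>C x)"
  shows "is_direct_sum (range A) (null_space A)"
proof -
  have bl: "bounded_linear A" and AC: "A (z *\<^sub>C x) = z *\<^sub>C A x" for z x
    using A by (auto simp: bounded_clinear_def)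
  interpret bounded_linear A by (rule bl)
  obtain K where K: "K > 0" "\<And>x. norm (A x) \<le> norm x * K" using pos_bounded by auto
  obtain E z1 where E: "connected E" "E \<subseteq> C - {0}" "0 \<in> closure E" "z1 \<in> E" "cmod z1 > K"
    using unbounded_curve_excursion[OF C] by blast
  have cE: "c * norm (A x) \<le> norm (A x - z *\<^sub>C x)" if "z \<in> E" for z x
    using c(2) that E(2) by blast
  have smallE: "\<exists>z\<in>E. z \<noteq> 0 \<and> cmod z < e" if "e > 0" for e
    using E(2,3) that by (fastforce simp: closure_approachable)
  have sum_below: "c * norm (A u) \<le> norm (A u + n)" if n: "A n = 0" for u n
  proof (rule field_le_epsilon)
    fix e :: real assume e: "e > 0"
    then have "e / (norm u + 1) > 0" by (simp add: add_nonneg_pos)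
    then obtain z where z: "z \<in> E" "z \<noteq> 0" "cmod z < e / (norm u + 1)"
      using smallE by blast
    have "cmod z * norm u \<le> cmod z * (norm u + 1)" by (simp add: mult_left_mono)
    also have "\<dots> < e" using z(3) by (simp add: pos_less_divide_eq add_nonneg_pos)
    finally have zu: "norm (z *\<^sub>C u) < e" by (simp add: norm_scaleC)
    \<comment> \<open>Chosen so that \<open>A x = A u\<close>, while \<open>A x - z x\<close> tends to \<open>A u + n\<close> as \<open>z\<close> tends to \<open>0\<close>.\<close>
    define x where "x = u - inverse z *\<^sub>C n"
    have Ax: "A x = A u" by (simp add: x_def diff AC n scaleC_zero_right)
    have "z *\<^sub>C x = z *\<^sub>C u - n"
      using z(2) scaleC_of_real[of 1 n]
      by (simp add: x_def linear_diff[OF bounded_linear.linear[OF bounded_linear_scaleC]] scaleC_scaleC)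
    then have eq: "A u + n - z *\<^sub>C u = A x - z *\<^sub>C x" by (simp add: Ax)
    have "c * norm (A u) \<le> norm (A u + n - z *\<^sub>C u)"
      unfolding eq using cE[OF z(1), of x] by (simp add: Ax)
    also have "\<dots> \<le> norm (A u + n) + norm (z *\<^sub>C u)" by (rule norm_triangle_ineq4)
    finally show "c * norm (A u) \<le> norm (A u + n) + e" using zu by simp
  qed
  have disj: "range A \<inter> null_space A = {0}"
  proof -
    \<comment> \<open>Here \<open>n = - A u\<close> is in \<open>N(A)\<close>, and the sum in
      \<open>sum_below\<close> vanishes.\<close>
    have "A u = 0" if "A (A u) = 0" for u
      using sum_below[of "- A u" u] that c(1) by (simp add: neg mult_le_0_iff)
    then show ?thesis by (auto simp: null_space_def zero intro: range_eqI[of _ _ 0])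
  qed
  have clsum: "closed (range A + null_space A)"
    unfolding closed_sequential_limits
  proof (intro allI impI, elim conjE)
    fix s l assume s: "\<forall>k. s k \<in> range A + null_space A" "s \<longlonglongrightarrow> l"
    have "\<exists>x n. A n = 0 \<and> s k = A x + n" for k
      using s(1)[rule_format, of k] by (auto simp: null_space_def elim!: set_plus_elim)
    then obtain x n where xn: "\<And>k. A (n k) = 0" "\<And>k. s k = A (x k) + n k" by metis
    \<comment> \<open>Applied to differences, \<open>sum_below\<close> transfers the Cauchy property
      from the sums to their \<open>R(A)\<close> components; the \<open>N(A)\<close> components then
      converge as well.\<close>
    have "Cauchy (\<lambda>k. A (x k))"
    proof (rule metric_CauchyI)
      fix e :: real assume "e > 0"
      then obtain M where M: "\<And>i j. i \<ge> M \<Longrightarrow> j \<ge> M \<Longrightarrow> dist (s i) (s j) < c * e"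
        using metric_CauchyD[OF LIMSEQ_imp_Cauchy[OF s(2)], of "c * e"] c(1) by auto
      have "dist (A (x i)) (A (x j)) < e" if "i \<ge> M" "j \<ge> M" for i j
      proof -
        have "c * norm (A (x i - x j)) \<le> norm (A (x i - x j) + (n i - n j))"
          by (rule sum_below) (simp add: diff xn)
        also have "\<dots> = dist (s i) (s j)" by (simp add: xn dist_norm diff algebra_simps)
        also have "\<dots> < c * e" using M that by blast
        finally show ?thesis using c(1) by (simp add: dist_norm diff)
      qed
      then show "\<exists>M. \<forall>i\<ge>M. \<forall>j\<ge>M. dist (A (x i)) (A (x j)) < e" by blast
    qed
    then obtain r where r: "(\<lambda>k. A (x k)) \<longlonglongrightarrow> r" using Cauchy_convergent convergentD by blast
    have "r \<in> range A" by (rule closed_sequentially[OF cl _ r]) auto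
    moreover have "(\<lambda>k. s k - A (x k)) \<longlonglongrightarrow> l - r" by (intro tendsto_diff s r)
    then have "n \<longlonglongrightarrow> l - r" by (simp add: xn)
    then have "(\<lambda>k. A (n k)) \<longlonglongrightarrow> A (l - r)" by (rule tendsto)
    then have "l - r \<in> null_space A" by (simp add: xn null_space_def LIMSEQ_const_iff)
    ultimately have "r + (l - r) \<in> range A + null_space A" by (rule set_plus_intro)
    then show "l \<in> range A + null_space A" by simp
  qed
  obtain L where L: "L > 0" "\<And>y. y \<in> range A \<Longrightarrow> \<exists>x. A x = y \<and> norm x \<le> L * norm y"
    using open_mapping_closed_range[OF bl, of UNIV] cl by auto
  have "y \<in> closure (range A + null_space A)" for y
    unfolding closure_approachable
  proof (intro allI impI)
    fix e :: real assume e: "e > 0"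
    \<comment> \<open>\<open>L * (norm y / c)\<close> will bound \<open>L * norm (A u)\<close>; the
      added 1 keeps \<open>b\<close> positive when \<open>y = 0\<close>.\<close>
    define b where "b = L * (norm y / c) + 1"
    have b: "b > 0" using L(1) c(1) by (simp add: b_def add_nonneg_pos)
    then obtain z where z: "z \<in> E" "z \<noteq> 0" "cmod z < e / b" using smallE[of "e / b"] e by auto
    have "surj (\<lambda>x. A x - z *\<^sub>C x)"
      using E K c by (intro angle_imp_surj[OF bl E(1) _ E(4,5) _ _ c(1) cE z(1)]) (auto simp: mult.commute)
    then obtain u where u: "y = A u - z *\<^sub>C u" using surjD[of "\<lambda>x. A x - z *\<^sub>C x" y] by blast
    have Au: "norm (A u) \<le> norm y / c" using cE[OF z(1), of u] c(1) by (simp add: u field_simps)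
    \<comment> \<open>\<open>- z u\<close> is nearly in \<open>N(A)\<close>: its image is small, hence is the image of a small vector \<open>w\<close>.\<close>
    have "A (- (z *\<^sub>C u)) \<in> range A" by blast
    then obtain w where w: "A w = A (- (z *\<^sub>C u))" "norm w \<le> L * norm (A (- (z *\<^sub>C u)))"
      using L(2) by blast
    have "norm w \<le> L * (cmod z * norm (A u))" using w(2) by (simp add: neg AC norm_scaleC)
    also have "\<dots> \<le> L * (cmod z * (norm y / c))" using L(1) Au by (intro mult_left_mono) auto
    also have "\<dots> = cmod z * (b - 1)" by (simp add: b_def)
    also have "\<dots> \<le> cmod z * b" by (intro mult_left_mono) auto
    also have "\<dots> < e" using z(3) b by (simp add: pos_less_divide_eq)
    finally have "norm w < e" .
    moreover have "- (z *\<^sub>C u) - w \<in> null_space A" using w(1) by (simp add: null_space_def diff)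
    then have "A u + (- (z *\<^sub>C u) - w) \<in> range A + null_space A" by (intro set_plus_intro) auto
    \<comment> \<open>The chosen point of the sum differs from \<open>y = A u - z u\<close> exactly
      by \<open>w\<close>.\<close>
    ultimately show "\<exists>p\<in>range A + null_space A. dist p y < e"
      by (intro bexI[of _ "A u + (- (z *\<^sub>C u) - w)"]) (auto simp: u dist_norm)
  qed
  then have "range A + null_space A = UNIV" using clsum by (auto simp: closure_closed)
  then show ?thesis using disj by (simp add: is_direct_sum_def)
qed

section \<open>Both directions combined, for the unbounded component of the resolvent set\<close>

text \<open>All \<open>z\<close> of modulus beyond the norm of \<open>A\<close> lie in the resolvent
  set and form a connected set, which every unbounded component meets. So there is only one
  unbounded component, and \<open>D\<close> is it.\<close>

theorem theorem1:
  fixes A :: "'a::complex_banach \<Rightarrow> 'a" and D :: "complex set"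
  assumes "bounded_clinear A"
    and "D \<in> components (resolvent_set A)" and "\<not> bounded D"
    and "0 \<in> closure D"
  shows "is_direct_sum (range A) (null_space A) \<longleftrightarrow>
    closed (range A) \<and> (\<exists>C. unbounded_curve_from_0 C \<and> operator_angle C A < pi)"
proof -
  have bl: "bounded_linear A" using assms(1) by (simp add: bounded_clinear_def)
  have angle: "operator_angle C A < pi \<longleftrightarrow>
      (\<exists>c>0. \<forall>x. \<forall>z\<in>C. c * norm (A x) \<le> norm (A x - z *\<^sub>C x))"
    if "unbounded_curve_from_0 C" for C
    using that by (intro operator_angle_less_pi_iff bl) (force simp: unbounded_curve_from_0_def)
  show ?thesis
  proof (intro iffI conjI; (elim conjE exE)?)
    assume ds: "is_direct_sum (range A) (null_space A)"
    show "closed (range A)" by (rule direct_sum_imp_closed_range(1)[OF bl ds])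
    obtain C c where "unbounded_curve_from_0 C" "c > 0"
      "\<And>x z. z \<in> C \<Longrightarrow> c * norm (A x) \<le> norm (A x - z *\<^sub>C x)"
      using direct_sum_imp_angle[OF assms(1) in_components_connected[OF assms(2)]
          in_components_subset[OF assms(2)] assms(3,4) ds] by blast
    then show "\<exists>C. unbounded_curve_from_0 C \<and> operator_angle C A < pi" using angle by blast
  next
    fix C assume "closed (range A)" "unbounded_curve_from_0 C" "operator_angle C A < pi"
    then show "is_direct_sum (range A) (null_space A)"
      using angle angle_imp_direct_sum[OF assms(1)] by metis
  qed
qed

end
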